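(* For all integers $n\ge 1$ and $k$, $$\mathfrak C_{2n}^{(k)}=\sum_{m=1}^n\sum_{l=1}^m\frac{(-4)^{n-m}}{(2m)!}\left[ {n \atop m} \right]_2\left[ {m \atop l} \right]_2\mathfrak B_{2l}^{(k)}.$$
   Context: The Stirling numbers of the first kind with level $2$, $\left[ {n \atop k} \right]_2$ ($n,k\ge0$), are defined by $\left[ {n \atop k} \right]_2=\left[ {n-1 \atop k-1} \right]_2+(n-1)^2\left[ {n-1 \atop k} \right]_2$ with $\left[ {0 \atop 0} \right]_2=1$ and $\left[ {n \atop 0} \right]_2=\left[ {0 \atop n} \right]_2=0$ for $n\ge1$ (equivalently $x(x+1^2)(x+2^2)\cdots(x+(n-1)^2)=\sum_{k}\left[ {n \atop k} \right]_2x^k$). For an integer $k$, the poly-Bernoulli numbers with level $2$ are defined by $\sum_{n\ge0}\mathfrak B_n^{(k)}\frac{x^n}{n!}=\frac{{\rm Li}_{2,k}(2\sin(x/2))}{2\sin(x/2)}$ with ${\rm Li}_{2,k}(z)=\sum_{n\ge0}\frac{z^{2n+1}}{(2n+1)^k}$, and the poly-Cauchy numbers with level $2$ are defined by $\sum_{n\ge0}\mathfrak C_n^{(k)}\frac{x^n}{n!}={\rm Lif}_{2,k}({\rm arcsinh}\,x)$ with ${\rm Lif}_{2,k}(z)=\sum_{m\ge0}\frac{z^{2m}}{(2m)!(2m+1)^k}$ (as power series). *)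

theory Defs
  imports Complex_Main "HOL-Computational_Algebra.Formal_Power_Series"
begin

text \<open>All generating functions are formal power series over the reals.\<close>

fun stirling1_level2 :: "nat \<Rightarrow> nat \<Rightarrow> nat" where
  "stirling1_level2 0 0 = 1"
| "stirling1_level2 0 (Suc k) = 0"
| "stirling1_level2 (Suc n) 0 = 0"
| "stirling1_level2 (Suc n) (Suc k) =
     stirling1_level2 n k + n ^ 2 * stirling1_level2 n (Suc k)"

definition fps_Li2 :: "int \<Rightarrow> real fps" where
  "fps_Li2 k = Abs_fps (\<lambda>i. if odd i then 1 / (real i powi k) else 0)"

definition fps_Lif2 :: "int \<Rightarrow> real fps" where
  "fps_Lif2 k = Abs_fps (\<lambda>i. if even i then 1 / (fact i * (real (i + 1) powi k)) else 0)"

text \<open>The series of \<open>2 sin (x/2)\<close>; \<^const>\<open>fps_sin\<close> takes the frequency as its argument.\<close>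

definition fps_two_sin_half :: "real fps" where
  "fps_two_sin_half = fps_const 2 * fps_sin (1 / 2)"

definition fps_sinh :: "real fps" where
  "fps_sinh = fps_const (1 / 2) * (fps_exp 1 - fps_exp (- 1))"

text \<open>The library has no series for \<open>arcsinh\<close>; it is the compositional inverse of \<open>sinh\<close>.\<close>

definition fps_arcsinh :: "real fps" where
  "fps_arcsinh = fps_inv fps_sinh"

lemma fps_sinh_oo_arcsinh: "fps_sinh oo fps_arcsinh = fps_X"
  unfolding fps_arcsinh_def by (rule fps_inv_right) (simp_all add: fps_sinh_def)

lemma fps_arcsinh_oo_sinh: "fps_arcsinh oo fps_sinh = fps_X"
  unfolding fps_arcsinh_def by (rule fps_inv) (simp_all add: fps_sinh_def)

definition poly_Bernoulli_level2 :: "int \<Rightarrow> nat \<Rightarrow> real" where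
  "poly_Bernoulli_level2 k n =
     fact n * fps_nth ((fps_Li2 k oo fps_two_sin_half) / fps_two_sin_half) n"

text \<open>The quotient above is exact: the divisor has order 1, and the dividend has no constant term.\<close>

lemma Li2_quotient_exact:
  "(fps_Li2 k oo fps_two_sin_half) / fps_two_sin_half * fps_two_sin_half
     = fps_Li2 k oo fps_two_sin_half"
proof -
  have nz: "fps_nth fps_two_sin_half 1 \<noteq> 0"
    by (simp add: fps_two_sin_half_def fps_sin_def)
  have "subdegree fps_two_sin_half \<le> 1"
    using nz by (rule subdegree_leI)
  moreover have "1 \<le> subdegree (fps_Li2 k oo fps_two_sin_half)"
    if "fps_Li2 k oo fps_two_sin_half \<noteq> 0"
    using that by (intro subdegree_geI) (auto simp: fps_Li2_def)
  moreover have "fps_two_sin_half \<noteq> 0"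
    using nz by auto
  ultimately have "fps_two_sin_half dvd fps_Li2 k oo fps_two_sin_half"
    by (cases "fps_Li2 k oo fps_two_sin_half = 0") (auto simp: fps_dvd_iff)
  then show ?thesis by simp
qed

definition poly_Cauchy_level2 :: "int \<Rightarrow> nat \<Rightarrow> real" where
  "poly_Cauchy_level2 k n = fact n * fps_nth (fps_Lif2 k oo fps_arcsinh) n"

end

theory Submission
  imports Defs
begin

text \<open>
  Put \<open>S = 2 sin (x/2)\<close> and \<open>A = arcsinh x\<close>.  Since \<open>S'\<^sup>2 = 1 - S\<^sup>2/4\<close> and \<open>S'' = -S/4\<close>, the
  operator \<open>D\<^sup>2 + j\<^sup>2\<close> sends \<open>S\<^bsup>2j\<^esup>\<close> to \<open>2j(2j-1) S\<^bsup>2j-2\<^esup>\<close>; hence \<open>D\<^sup>2(D\<^sup>2+1\<^sup>2)\<dots>(D\<^sup>2+(m-1)\<^sup>2)\<close>, whose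
  coefficients are the level 2 Stirling numbers, extracts at \<open>x = 0\<close> the coefficient of \<open>S\<^bsup>2m\<^esup>\<close>.
  Applied to the generating function of the poly-Bernoulli numbers it gives
  \<open>(2m)! / (2m+1)\<^sup>k\<close>.  On the other side \<open>(1+x\<^sup>2) F'' + x F'\<close> sends \<open>A\<^bsup>2m\<^esup>/(2m)!\<close> to
  \<open>A\<^bsup>2m-2\<^esup>/(2m-2)!\<close>, which makes \<open>(-4)\<^bsup>n-m\<^esup>\<close> times the Stirling number the coefficient of
  \<open>x\<^bsup>2n\<^esup>/(2n)!\<close> in that power.
\<close>

section \<open>Level 2 Stirling numbers\<close>

lemma stirling1_level2_eq_0: "n < k \<Longrightarrow> stirling1_level2 n k = 0"
  by (induction n k rule: stirling1_level2.induct) auto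

lemma stirling1_level2_0_right: "n \<ge> 1 \<Longrightarrow> stirling1_level2 n 0 = 0"
  by (cases n) auto

text \<open>The Stirling recurrence in operator form: if \<open>f l\<close> stands for
  \<open>x ^ l\<close>, passing from \<open>m\<close> to \<open>Suc m\<close> multiplies the
  generating polynomial by \<open>x + m\<^sup>2\<close>.\<close>

lemma sum_stirling1_level2_Suc:
  fixes f :: "nat \<Rightarrow> 'a :: comm_semiring_1"
  shows "(\<Sum>l\<le>Suc m. of_nat (stirling1_level2 (Suc m) l) * f l) =
    (\<Sum>l\<le>m. of_nat (stirling1_level2 m l) * f (Suc l))
      + of_nat m ^ 2 * (\<Sum>l\<le>m. of_nat (stirling1_level2 m l) * f l)"
proof -
  have "(\<Sum>l\<le>Suc m. of_nat (stirling1_level2 (Suc m) l) * f l) =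
      (\<Sum>l\<le>m. of_nat (stirling1_level2 m l) * f (Suc l))
      + of_nat m ^ 2 * (\<Sum>l\<le>m. of_nat (stirling1_level2 m (Suc l)) * f (Suc l))"
    by (subst sum.atMost_Suc_shift)
       (simp add: sum.distrib sum_distrib_left algebra_simps)
  \<comment> \<open>The added term \<open>l = 0\<close> is harmless: its Stirling number is 0 for
    positive \<open>m\<close>, and the factor \<open>m ^ 2\<close> kills it for
    \<open>m = 0\<close>.\<close>
  also have "of_nat m ^ 2 * (\<Sum>l\<le>m. of_nat (stirling1_level2 m (Suc l)) * f (Suc l)) =
      of_nat m ^ 2 * (\<Sum>l\<le>Suc m. of_nat (stirling1_level2 m l) * f l)"
    by (subst sum.atMost_Suc_shift)
       (cases "m = 0"; simp add: stirling1_level2_0_right)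
  also have "(\<Sum>l\<le>Suc m. of_nat (stirling1_level2 m l) * f l) =
      (\<Sum>l\<le>m. of_nat (stirling1_level2 m l) * f l)"
    by (simp add: stirling1_level2_eq_0)
  finally show ?thesis .
qed

section \<open>Powers and composition of power series\<close>

lemma fps_deriv_power_Suc:
  fixes f :: "'a :: comm_ring_1 fps"
  shows "fps_deriv (f ^ Suc n) = of_nat (Suc n) * (fps_deriv f * f ^ n)"
  by (simp only: fps_deriv_power fps_of_nat mult.assoc diff_Suc_1)

lemma fps_deriv2_power:
  fixes f :: "'a :: comm_ring_1 fps"
  shows "fps_deriv (fps_deriv (f ^ (p + 2))) = of_nat (p + 2) *
    (fps_deriv (fps_deriv f) * f ^ (p + 1) + of_nat (p + 1) * fps_deriv f ^ 2 * f ^ p)"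
proof -
  have "fps_deriv (fps_deriv (f ^ (p + 2))) =
      of_nat (p + 2) * fps_deriv (fps_deriv f * f ^ (p + 1))"
    using fps_deriv_power_Suc[of f "p + 1"] by simp
  also have "fps_deriv (fps_deriv f * f ^ (p + 1)) =
      fps_deriv (fps_deriv f) * f ^ (p + 1) + fps_deriv f * fps_deriv (f ^ Suc p)"
    by simp
  also have "fps_deriv f * fps_deriv (f ^ Suc p) = of_nat (p + 1) * fps_deriv f ^ 2 * f ^ p"
    unfolding fps_deriv_power_Suc by (simp add: power2_eq_square mult_ac)
  finally show ?thesis .
qed

lemma fps_nth_deriv2:
  fixes f :: "'a :: comm_ring_1 fps"
  shows "fps_nth (fps_deriv (fps_deriv f)) i = of_nat ((i + 2) * (i + 1)) * fps_nth f (i + 2)"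
  by (simp add: algebra_simps)

text \<open>Terms with \<open>j > l\<close> vanish because \<open>g ^ (2 * j)\<close> has no
  coefficients below \<open>2 * j\<close>. The free bound \<open>N\<close> lets different
  \<open>l\<close> share one range of summation, so that sums can be exchanged.\<close>

lemma fps_compose_nth_even:
  fixes f g :: "'a :: comm_ring_1 fps"
  assumes odd: "\<And>i. odd i \<Longrightarrow> fps_nth f i = 0"
    and g: "fps_nth g 0 = 0" and "l \<le> N"
  shows "fps_nth (f oo g) (2 * l) = (\<Sum>j\<le>N. fps_nth f (2 * j) * fps_nth (g ^ (2 * j)) (2 * l))"
proof -
  have "fps_nth (f oo g) (2 * l) = (\<Sum>i\<in>{0..2*l}. fps_nth f i * fps_nth (g ^ i) (2 * l))"
    by (simp add: fps_compose_nth)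
  also have "\<dots> = (\<Sum>i\<in>(*) 2 ` {..N}. fps_nth f i * fps_nth (g ^ i) (2 * l))"
  proof (rule sum.mono_neutral_cong)
    fix i assume "i \<in> {0..2*l} - (*) 2 ` {..N}"
    then have "odd i" using \<open>l \<le> N\<close> by (auto elim!: evenE)
    then show "fps_nth f i * fps_nth (g ^ i) (2 * l) = 0"
      by (simp add: odd)
  next
    fix i assume "i \<in> (*) 2 ` {..N} - {0..2*l}"
    then show "fps_nth f i * fps_nth (g ^ i) (2 * l) = 0"
      using startsby_zero_power_prefix[OF g] by auto
  qed auto
  also have "\<dots> = (\<Sum>j\<le>N. fps_nth f (2 * j) * fps_nth (g ^ (2 * j)) (2 * l))"
    by (subst sum.reindex) (auto simp: inj_on_def)
  finally show ?thesis .
qed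

section \<open>Powers of the hyperbolic arcsine\<close>

lemma fps_nth_arcsinh_0 [simp]: "fps_nth fps_arcsinh 0 = 0"
  by (simp add: fps_arcsinh_def fps_inv_def)

text \<open>This is cosh^2 = 1 + sinh^2, with cosh appearing as the derivative of sinh.\<close>

lemma fps_deriv_sinh_power2: "fps_deriv fps_sinh ^ 2 = 1 + fps_sinh ^ 2"
proof -
  have e: "fps_exp 1 * fps_exp (- 1) = (1 :: real fps)"
    by (simp flip: fps_exp_add_mult)
  have d: "fps_deriv fps_sinh = fps_const (1 / 2) * (fps_exp 1 + fps_exp (- 1))"
    by (simp add: fps_sinh_def flip: fps_const_neg)
  have "fps_deriv fps_sinh ^ 2 - fps_sinh ^ 2 =
      fps_const (1 / 2) ^ 2 * 4 * (fps_exp 1 * fps_exp (- 1))"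
    unfolding d unfolding fps_sinh_def by algebra
  also have "\<dots> = 1"
    unfolding e by (simp add: power2_eq_square numeral_fps_const)
  finally show ?thesis by (simp add: algebra_simps)
qed

text \<open>Differentiate sinh(arcsinh x) = x and square; the squared form avoids a square root
  series.\<close>

lemma fps_deriv_arcsinh_power2: "(1 + fps_X ^ 2) * fps_deriv fps_arcsinh ^ 2 = 1"
proof -
  have "fps_deriv (fps_sinh oo fps_arcsinh) = 1"
    by (simp add: fps_sinh_oo_arcsinh)
  then have "((fps_deriv fps_sinh oo fps_arcsinh) * fps_deriv fps_arcsinh) ^ 2 = 1"
    by (simp add: fps_compose_deriv)
  moreover have "(fps_deriv fps_sinh oo fps_arcsinh) ^ 2 = 1 + fps_X ^ 2"
  proof -
    have "(fps_deriv fps_sinh oo fps_arcsinh) ^ 2 = fps_deriv fps_sinh ^ 2 oo fps_arcsinh"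
      by (simp add: fps_compose_power)
    also have "\<dots> = 1 + (fps_sinh oo fps_arcsinh) ^ 2"
      by (simp add: fps_deriv_sinh_power2 fps_compose_add_distrib fps_compose_power)
    finally show ?thesis by (simp add: fps_sinh_oo_arcsinh)
  qed
  ultimately show ?thesis
    by (simp add: power_mult_distrib)
qed

text \<open>Differentiating the squared identity leaves a factor \<open>2 * ?A'\<close>, which
  cancels since real power series form an integral domain.\<close>

lemma fps_deriv2_arcsinh:
  "(1 + fps_X ^ 2) * fps_deriv (fps_deriv fps_arcsinh) + fps_X * fps_deriv fps_arcsinh = 0"
proof -
  let ?A' = "fps_deriv fps_arcsinh"
  have "fps_deriv ((1 + fps_X ^ 2) * ?A' ^ 2) = 0"
    by (simp add: fps_deriv_arcsinh_power2)
  then have "2 * ?A' * ((1 + fps_X ^ 2) * fps_deriv ?A' + fps_X * ?A') = 0"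
    by (simp add: power2_eq_square algebra_simps)
  moreover have "?A' \<noteq> 0"
    using fps_deriv_arcsinh_power2 by force
  ultimately show ?thesis by simp
qed

lemma fps_arcsinh_power_ode:
  fixes p :: nat
  defines "F \<equiv> fps_arcsinh ^ (p + 2)"
  shows "(1 + fps_X ^ 2) * fps_deriv (fps_deriv F) + fps_X * fps_deriv F
    = of_nat ((p + 2) * (p + 1)) * fps_arcsinh ^ p"
proof -
  let ?A = fps_arcsinh
  have F': "fps_deriv F = of_nat (p + 2) * (fps_deriv ?A * ?A ^ (p + 1))"
    unfolding F_def using fps_deriv_power_Suc[of ?A "p + 1"] by simp
  have F'': "fps_deriv (fps_deriv F) = of_nat (p + 2) *
      (fps_deriv (fps_deriv ?A) * ?A ^ (p + 1) + of_nat (p + 1) * fps_deriv ?A ^ 2 * ?A ^ p)"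
    unfolding F_def by (rule fps_deriv2_power)
  have "(1 + fps_X ^ 2) * fps_deriv (fps_deriv F) + fps_X * fps_deriv F =
      of_nat (p + 2) * (((1 + fps_X ^ 2) * fps_deriv (fps_deriv ?A) + fps_X * fps_deriv ?A) * ?A ^ (p + 1)
        + of_nat (p + 1) * ((1 + fps_X ^ 2) * fps_deriv ?A ^ 2) * ?A ^ p)"
    unfolding F'' unfolding F' by (simp only: algebra_simps)
  then show ?thesis
    by (simp only: fps_deriv2_arcsinh fps_deriv_arcsinh_power2) (simp add: algebra_simps)
qed

lemma fps_nth_arcsinh_power_rec:
  "fact (2 * n + 2) * fps_nth (fps_arcsinh ^ (p + 2)) (2 * n + 2) =
    real ((p + 2) * (p + 1)) * (fact (2 * n) * fps_nth (fps_arcsinh ^ p) (2 * n))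
    - 4 * real n ^ 2 * (fact (2 * n) * fps_nth (fps_arcsinh ^ (p + 2)) (2 * n))"
proof -
  let ?F = "fps_arcsinh ^ (p + 2)"
  have "fps_nth ((1 + fps_X ^ 2) * fps_deriv (fps_deriv ?F) + fps_X * fps_deriv ?F) (2 * n) =
      real ((p + 2) * (p + 1)) * fps_nth (fps_arcsinh ^ p) (2 * n)"
    by (subst fps_arcsinh_power_ode) (simp flip: fps_of_nat del: of_nat_mult)
  \<comment> \<open>The terms x^2 F'' and x F' contribute 2n(2n-1) + 2n = 4n^2 times the coefficient
    of x^(2n).\<close>
  moreover have "fps_nth ((1 + fps_X ^ 2) * fps_deriv (fps_deriv F) + fps_X * fps_deriv F) (2 * n) =
      real ((2 * n + 2) * (2 * n + 1)) * fps_nth F (2 * n + 2) + 4 * real n ^ 2 * fps_nth F (2 * n)"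
    for F :: "real fps"
    by (cases n) (simp_all add: distrib_right fps_X_power_mult_nth power2_eq_square algebra_simps)
  ultimately have "real ((2 * n + 2) * (2 * n + 1)) * fps_nth ?F (2 * n + 2) =
      real ((p + 2) * (p + 1)) * fps_nth (fps_arcsinh ^ p) (2 * n) - 4 * real n ^ 2 * fps_nth ?F (2 * n)"
    by (metis add_diff_cancel_right')
  moreover have "fact (2 * n + 2) = real ((2 * n + 2) * (2 * n + 1)) * fact (2 * n)"
    by (simp add: algebra_simps)
  ultimately show ?thesis
    by (simp only: mult.assoc mult.left_commute[of _ "fact (2 * n)"] right_diff_distrib)
qed

lemma fps_nth_arcsinh_power_even:
  "fact (2 * n) * fps_nth (fps_arcsinh ^ (2 * m)) (2 * n) =
    fact (2 * m) * ((- 4) ^ (n - m) * real (stirling1_level2 n m))"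
proof (induction n arbitrary: m)
  case 0
  show ?case by (cases m) (simp_all add: fps_power_zeroth)
next
  case (Suc n)
  show ?case
  proof (cases m)
    case 0
    then show ?thesis by simp
  next
    case (Suc p)
    \<comment> \<open>For \<open>p \<ge> n\<close> truncated subtraction breaks the power law, but
      then the Stirling number is 0.\<close>
    have e: "(- 4 :: real) ^ (n - p) * real (stirling1_level2 n (Suc p))
        = - 4 * (- 4) ^ (n - Suc p) * real (stirling1_level2 n (Suc p))"
    proof (cases "p < n")
      case True
      then have "n - p = Suc (n - Suc p)" by simp
      then show ?thesis by simp
    qed (simp add: stirling1_level2_eq_0)
    have "fact (2 * Suc n) * fps_nth (fps_arcsinh ^ (2 * m)) (2 * Suc n) =
        real ((2 * p + 2) * (2 * p + 1)) * (fact (2 * n) * fps_nth (fps_arcsinh ^ (2 * p)) (2 * n))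
        - 4 * real n ^ 2 * (fact (2 * n) * fps_nth (fps_arcsinh ^ (2 * Suc p)) (2 * n))"
      using fps_nth_arcsinh_power_rec[of n "2 * p"] by (simp add: Suc)
    also have "\<dots> = real ((2 * p + 2) * (2 * p + 1)) * fact (2 * p) * ((- 4) ^ (n - p) * real (stirling1_level2 n p))
        - 4 * real n ^ 2 * (fact (2 * Suc p) * ((- 4) ^ (n - Suc p) * real (stirling1_level2 n (Suc p))))"
      by (simp only: Suc.IH mult.assoc)
    also have "real ((2 * p + 2) * (2 * p + 1)) * fact (2 * p) = fact (2 * Suc p)"
      by (simp add: algebra_simps)
    also have "fact (2 * Suc p) * ((- 4) ^ (n - p) * real (stirling1_level2 n p))
        - 4 * real n ^ 2 * (fact (2 * Suc p) * ((- 4) ^ (n - Suc p) * real (stirling1_level2 n (Suc p))))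
       = fact (2 * Suc p) * ((- 4) ^ (n - p) * real (stirling1_level2 n p)
          + real n ^ 2 * ((- 4) ^ (n - p) * real (stirling1_level2 n (Suc p))))"
      unfolding e by (simp only: ring_distribs) simp
    also have "\<dots> = fact (2 * Suc p) * ((- 4) ^ (n - p) * real (stirling1_level2 (Suc n) (Suc p)))"
      by (simp add: ring_distribs)
    finally show ?thesis by (simp add: Suc)
  qed
qed

lemma poly_Cauchy_level2_eq:
  "poly_Cauchy_level2 k (2 * n) =
    (\<Sum>m\<le>n. (- 4) ^ (n - m) * real (stirling1_level2 n m) / real (2 * m + 1) powi k)"
proof -
  have "poly_Cauchy_level2 k (2 * n) = (\<Sum>m\<le>n. fps_nth (fps_Lif2 k) (2 * m) *
      (fact (2 * n) * fps_nth (fps_arcsinh ^ (2 * m)) (2 * n)))"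
    unfolding poly_Cauchy_level2_def
    by (subst fps_compose_nth_even[where N = n])
       (auto simp: fps_Lif2_def sum_distrib_left mult_ac)
  also have "\<dots> = (\<Sum>m\<le>n. (- 4) ^ (n - m) * real (stirling1_level2 n m) / real (2 * m + 1) powi k)"
    by (intro sum.cong refl, subst fps_nth_arcsinh_power_even) (simp add: fps_Lif2_def)
  finally show ?thesis .
qed

section \<open>Powers of twice the half-angle sine\<close>

lemma fps_nth_two_sin_half_0 [simp]: "fps_nth fps_two_sin_half 0 = 0"
  by (simp add: fps_two_sin_half_def fps_sin_def)

lemma fps_two_sin_half_nonzero: "fps_two_sin_half \<noteq> 0"
proof -
  have "fps_nth fps_two_sin_half 1 \<noteq> 0"
    by (simp add: fps_two_sin_half_def fps_sin_def)
  then show ?thesis by auto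
qed

lemma fps_deriv_two_sin_half: "fps_deriv fps_two_sin_half = fps_cos (1 / 2)"
  by (simp add: fps_two_sin_half_def fps_sin_deriv flip: mult.assoc)

lemma fps_deriv_two_sin_half_power2:
  "fps_deriv fps_two_sin_half ^ 2 = 1 - fps_const (1 / 4) * fps_two_sin_half ^ 2"
proof -
  have "fps_const (1 / 4 :: real) * fps_const 2 ^ 2 = 1"
    by (simp add: power2_eq_square)
  then have "fps_const (1 / 4) * fps_two_sin_half ^ 2 = fps_sin (1 / 2) ^ 2"
    by (simp add: fps_two_sin_half_def power_mult_distrib flip: mult.assoc)
  then show ?thesis
    using fps_sin_cos_sum_of_squares[of "1 / 2 :: real"]
    by (simp add: fps_deriv_two_sin_half algebra_simps)
qed

lemma fps_deriv2_two_sin_half: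
  "fps_deriv (fps_deriv fps_two_sin_half) = - (fps_const (1 / 4) * fps_two_sin_half)"
  unfolding fps_deriv_two_sin_half
  by (simp add: fps_cos_deriv fps_two_sin_half_def del: fps_const_neg
      flip: mult.assoc fps_const_neg)

text \<open>With S'' = -S/4 and S'^2 = 1 - S^2/4, the coefficient of S^(p+2) is -(p+2)(1/4 +
  (p+1)/4).\<close>

lemma fps_two_sin_half_power_ode:
  "fps_deriv (fps_deriv (fps_two_sin_half ^ (p + 2))) =
    of_nat ((p + 2) * (p + 1)) * fps_two_sin_half ^ p
    - fps_const (real (p + 2) ^ 2 / 4) * fps_two_sin_half ^ (p + 2)"
proof -
  let ?S = fps_two_sin_half
  have "fps_deriv (fps_deriv (?S ^ (p + 2))) = of_nat (p + 2) *
      (fps_deriv (fps_deriv ?S) * ?S ^ (p + 1) + of_nat (p + 1) * fps_deriv ?S ^ 2 * ?S ^ p)"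
    by (rule fps_deriv2_power)
  also have "\<dots> = of_nat ((p + 2) * (p + 1)) * ?S ^ p -
      of_nat (p + 2) * of_nat (p + 2) * fps_const (1 / 4) * ?S ^ (p + 2)"
    unfolding fps_deriv2_two_sin_half fps_deriv_two_sin_half_power2
    by (simp add: power2_eq_square algebra_simps)
  also have "of_nat (p + 2) * of_nat (p + 2) * fps_const (1 / 4) = fps_const (real (p + 2) ^ 2 / 4)"
    by (simp only: power2_eq_square fps_const_mult flip: fps_of_nat) simp
  finally show ?thesis .
qed

lemma fps_nth_two_sin_half_power_rec:
  "fact (2 * l + 2) * fps_nth (fps_two_sin_half ^ (2 * j + 2)) (2 * l + 2) =
    real ((2 * j + 2) * (2 * j + 1)) * (fact (2 * l) * fps_nth (fps_two_sin_half ^ (2 * j)) (2 * l))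
    - real (Suc j) ^ 2 * (fact (2 * l) * fps_nth (fps_two_sin_half ^ (2 * j + 2)) (2 * l))"
proof -
  let ?F = "fps_two_sin_half ^ (2 * j + 2)"
  have "real ((2 * l + 2) * (2 * l + 1)) * fps_nth ?F (2 * l + 2)
      = fps_nth (fps_deriv (fps_deriv ?F)) (2 * l)"
    by (rule fps_nth_deriv2[symmetric])
  also have "\<dots> = real ((2 * j + 2) * (2 * j + 1)) * fps_nth (fps_two_sin_half ^ (2 * j)) (2 * l)
      - real (Suc j) ^ 2 * fps_nth ?F (2 * l)"
  proof -
    have "real (2 * j + 2) ^ 2 / 4 = real (Suc j) ^ 2"
      by (simp add: power2_eq_square field_simps)
    then show ?thesis
      by (subst fps_two_sin_half_power_ode)
         (simp only: fps_sub_nth fps_mult_left_const_nth flip: fps_of_nat)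
  qed
  finally have "real ((2 * l + 2) * (2 * l + 1)) * fps_nth ?F (2 * l + 2) = \<dots>" .
  moreover have "fact (2 * l + 2) = real ((2 * l + 2) * (2 * l + 1)) * fact (2 * l)"
    by (simp add: algebra_simps)
  ultimately show ?thesis
    by (simp only: mult.assoc mult.left_commute[of _ "fact (2 * l)"] right_diff_distrib)
qed

text \<open>The Stirling matrix and the even derivatives of the even powers of
  \<open>fps_two_sin_half\<close> at 0 are inverse to each other up to factorials. Induction on
  \<open>m\<close> applies one more operator D^2 + m^2.\<close>

lemma sum_stirling1_level2_two_sin_half:
  "(\<Sum>l\<le>m. real (stirling1_level2 m l) * (fact (2 * l) * fps_nth (fps_two_sin_half ^ (2 * j)) (2 * l)))
    = (if j = m then fact (2 * m) else 0)"
proof (induction m arbitrary: j)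
  case 0
  show ?case by (simp add: fps_power_zeroth)
next
  case (Suc m)
  show ?case
  proof (cases j)
    case 0
    \<comment> \<open>The constant series 1 has no coefficient at a positive index, and
      \<open>m ^ 2\<close> times the induction hypothesis is 0 whether or not
      \<open>m = 0\<close>.\<close>
    then show ?thesis
      using Suc.IH[of 0] by (subst sum_stirling1_level2_Suc) auto
  next
    case (Suc p)
    define a where "a = (\<lambda>j l. fact (2 * l) * fps_nth (fps_two_sin_half ^ (2 * j)) (2 * l))"
    have a: "a (Suc p) (Suc l) =
        real ((2 * p + 2) * (2 * p + 1)) * a p l - real (Suc p) ^ 2 * a (Suc p) l" for l
      using fps_nth_two_sin_half_power_rec[of l p] by (simp add: a_def)
    have IH: "(\<Sum>l\<le>m. real (stirling1_level2 m l) * a i l) = (if i = m then fact (2 * m) else 0)" for i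
      using Suc.IH[of i] by (simp add: a_def)
    have "(\<Sum>l\<le>Suc m. real (stirling1_level2 (Suc m) l) * a (Suc p) l) =
        (\<Sum>l\<le>m. real (stirling1_level2 m l) * a (Suc p) (Suc l))
        + real m ^ 2 * (\<Sum>l\<le>m. real (stirling1_level2 m l) * a (Suc p) l)"
      by (rule sum_stirling1_level2_Suc)
    also have "(\<Sum>l\<le>m. real (stirling1_level2 m l) * a (Suc p) (Suc l)) =
        real ((2 * p + 2) * (2 * p + 1)) * (\<Sum>l\<le>m. real (stirling1_level2 m l) * a p l)
        - real (Suc p) ^ 2 * (\<Sum>l\<le>m. real (stirling1_level2 m l) * a (Suc p) l)"
      by (simp only: a right_diff_distrib sum_subtractf sum_distrib_left mult.left_commute)
    \<comment> \<open>The sum over \<open>a (Suc p) l\<close> carries the factor m^2 - (p+1)^2 and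
      is nonzero only for \<open>Suc p = m\<close>, where that factor is 0.\<close>
    finally have "(\<Sum>l\<le>Suc m. real (stirling1_level2 (Suc m) l) * a (Suc p) l) =
        (if p = m then real ((2 * m + 2) * (2 * m + 1)) * fact (2 * m) else 0)"
      unfolding IH by auto
    also have "real ((2 * m + 2) * (2 * m + 1)) * fact (2 * m) = fact (2 * Suc m)"
      by (simp add: algebra_simps)
    finally show ?thesis by (simp add: Suc a_def)
  qed
qed

text \<open>\<open>fps_Li2 k\<close> is \<open>fps_X\<close> times an even series, so composition
  yields a factor \<open>fps_two_sin_half\<close> that cancels the divisor.\<close>

lemma fps_Li2_compose_two_sin_half_quotient:
  "(fps_Li2 k oo fps_two_sin_half) / fps_two_sin_half =
    Abs_fps (\<lambda>i. if even i then 1 / real (i + 1) powi k else 0) oo fps_two_sin_half"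
proof -
  have "fps_Li2 k = fps_X * Abs_fps (\<lambda>i. if even i then 1 / real (i + 1) powi k else 0)"
    by (rule fps_ext) (auto simp: fps_Li2_def)
  then have "fps_Li2 k oo fps_two_sin_half = fps_two_sin_half *
      (Abs_fps (\<lambda>i. if even i then 1 / real (i + 1) powi k else 0) oo fps_two_sin_half)"
    by (simp add: fps_compose_mult_distrib)
  then show ?thesis
    by (simp add: fps_two_sin_half_nonzero)
qed

lemma poly_Bernoulli_level2_eq:
  assumes "l \<le> N"
  shows "poly_Bernoulli_level2 k (2 * l) =
    (\<Sum>j\<le>N. fact (2 * l) * fps_nth (fps_two_sin_half ^ (2 * j)) (2 * l) / real (2 * j + 1) powi k)"
  unfolding poly_Bernoulli_level2_def fps_Li2_compose_two_sin_half_quotient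
  by (subst fps_compose_nth_even[OF _ _ assms]) (auto simp: sum_distrib_left)

text \<open>Expand each poly-Bernoulli number over the common range \<open>j \<le> m\<close> and
  exchange the sums; only \<open>j = m\<close> survives.\<close>

lemma sum_stirling1_level2_poly_Bernoulli_level2:
  "(\<Sum>l\<le>m. real (stirling1_level2 m l) * poly_Bernoulli_level2 k (2 * l)) =
    fact (2 * m) / real (2 * m + 1) powi k"
proof -
  have "(\<Sum>l\<le>m. real (stirling1_level2 m l) * poly_Bernoulli_level2 k (2 * l)) =
      (\<Sum>l\<le>m. \<Sum>j\<le>m. real (stirling1_level2 m l) *
        (fact (2 * l) * fps_nth (fps_two_sin_half ^ (2 * j)) (2 * l)) / real (2 * j + 1) powi k)"
    by (intro sum.cong refl) (simp add: poly_Bernoulli_level2_eq[where N = m] sum_distrib_left)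
  also have "\<dots> = (\<Sum>j\<le>m. (\<Sum>l\<le>m. real (stirling1_level2 m l) *
        (fact (2 * l) * fps_nth (fps_two_sin_half ^ (2 * j)) (2 * l))) / real (2 * j + 1) powi k)"
    by (subst sum.swap) (simp add: sum_divide_distrib)
  also have "\<dots> = (\<Sum>j\<le>m. if j = m then fact (2 * m) / real (2 * m + 1) powi k else 0)"
    by (intro sum.cong refl, subst sum_stirling1_level2_two_sin_half) auto
  finally show ?thesis by simp
qed

theorem theorem7:
  fixes n :: nat and k :: int
  assumes "n \<ge> 1"
  shows "poly_Cauchy_level2 k (2 * n) =
    (\<Sum>m=1..n. \<Sum>l=1..m.
       (- 4) ^ (n - m) / fact (2 * m)
         * real (stirling1_level2 n m) * real (stirling1_level2 m l)
         * poly_Bernoulli_level2 k (2 * l))"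
proof -
  have atMost: "{..i} = insert 0 {1..i}" for i :: nat
    by auto
  \<comment> \<open>Since \<open>n \<ge> 1\<close>, the term \<open>m = 0\<close> has Stirling
    number 0 and drops out.\<close>
  have "poly_Cauchy_level2 k (2 * n) =
      (\<Sum>m=1..n. (- 4) ^ (n - m) * real (stirling1_level2 n m) / real (2 * m + 1) powi k)"
    using assms by (simp add: poly_Cauchy_level2_eq atMost stirling1_level2_0_right)
  \<comment> \<open>Both sides meet in 1/(2m+1)^k: it is the inner Bernoulli sum divided by
    \<open>fact (2 * m)\<close>.\<close>
  also have "\<dots> = (\<Sum>m=1..n. (- 4) ^ (n - m) / fact (2 * m) * real (stirling1_level2 n m) *
      (\<Sum>l=1..m. real (stirling1_level2 m l) * poly_Bernoulli_level2 k (2 * l)))"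
  proof (intro sum.cong refl)
    fix m assume "m \<in> {1..n}"
    then have "(\<Sum>l=1..m. real (stirling1_level2 m l) * poly_Bernoulli_level2 k (2 * l)) =
        fact (2 * m) / real (2 * m + 1) powi k"
      using sum_stirling1_level2_poly_Bernoulli_level2[of m k]
      by (simp add: atMost stirling1_level2_0_right)
    then show "(- 4) ^ (n - m) * real (stirling1_level2 n m) / real (2 * m + 1) powi k =
        (- 4) ^ (n - m) / fact (2 * m) * real (stirling1_level2 n m) *
        (\<Sum>l=1..m. real (stirling1_level2 m l) * poly_Bernoulli_level2 k (2 * l))"
      by simp
  qed
  finally show ?thesis
    by (simp add: sum_distrib_left mult.assoc)
qed

end
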